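(* Let $n \geqslant 3$ and let $G$ be a strongly connected simple digraph of order $n$. Then $$\left| D(G) - D(\overline{G}) \right| \leqslant n-2 \qquad\text{and}\qquad \frac{D(G)}{D(\overline{G})} \leqslant n-1 .$$ Moreover, each of these two equalities holds if and only if $G \in \mathscr{B}_n$.
   Context: Digraphs are simple (no loops, no multiple arrows; both $(u,v)$ and $(v,u)$ may be present). A digraph is strongly connected if there is a directed path between any ordered pair of vertices. For a strongly connected digraph, $|x,y|_G$ is the length (number of arrows) of a shortest directed path from $x$ to $y$, and the diameter $D(G)$ is the maximum of $|x,y|_G$ over all ordered pairs. The symmetric version $\overline{G}$ of $G=(V,A)$ is $(V,A')$ where $(i,j)\in A'$ iff $(i,j)\in A$ or $(j,i)\in A$. The backward tournament $\mathcal{B}_n$ ($n\geqslant 3$) has vertices $v_1,\dots,v_n$ and arrows $(v_i,v_{i+1})$ for $1\leqslant i\leqslant n-1$ and $(v_i,v_j)$ for $3\leqslant i\leqslant n$, $1\leqslant j\leqslant i-2$. $\mathscr{B}_n$ denotes the set of digraphs obtained from $\mathcal{B}_n$ by adding any subset of the arrows $(v_i,v_{i-1})$, $2\leqslant i\leqslant n$. *)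

theory Defs
  imports Graph_Theory.Graph_Theory
begin

text \<open>Only meaningful when there is a path from \<open>x\<close> to \<open>y\<close>; \<open>LEAST\<close> is unspecified otherwise.\<close>
definition dist_in :: "('a, 'b) pre_digraph \<Rightarrow> 'a \<Rightarrow> 'a \<Rightarrow> nat" where
  "dist_in G x y = (LEAST k. \<exists>p. pre_digraph.apath G x p y \<and> length p = k)"

text \<open>Sanity check: the distance is the library's shortest-path cost for unit arc costs.\<close>
lemma (in fin_digraph) dist_in_eq_\<mu>:
  assumes "x \<rightarrow>\<^sup>* y"
  shows "ereal (real (dist_in G x y)) = \<mu> (\<lambda>_. 1) x y"
proof -
  have cost: "awalk_cost (\<lambda>_. 1) p = real (length p)" for p :: "'b awalk"
    by (induct p) auto
  obtain p where p: "apath x p y" and \<mu>_p: "\<mu> (\<lambda>_. 1) x y = ereal (awalk_cost (\<lambda>_. 1) p)"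
    using min_cost_awalk[OF assms, of "\<lambda>_. 1"] by auto
  have "length p \<le> length q" if "apath x q y" for q
    using min_cost_le_walk_cost[of x q y "\<lambda>_. 1"] that \<mu>_p
    by (auto simp: apath_def cost)
  then have "dist_in G x y = length p"
    unfolding dist_in_def by (intro Least_equality) (use p in auto)
  then show ?thesis
    using \<mu>_p by (simp add: cost)
qed

text \<open>Only meaningful when \<open>G\<close> is finite and strongly connected.\<close>
definition diameter :: "('a, 'b) pre_digraph \<Rightarrow> nat" where
  "diameter G = Max {dist_in G x y | x y. x \<in> verts G \<and> y \<in> verts G}"

text \<open>The vertex \<open>v\<^sub>i\<close> is represented by the number \<open>i\<close>.\<close>
definition backward_tournament :: "nat \<Rightarrow> nat pair_pre_digraph" where
  "backward_tournament n =
    \<lparr> pverts = {1..n},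
      parcs = {(i, i + 1) | i. 1 \<le> i \<and> i \<le> n - 1} \<union>
              {(i, j) | i j. 3 \<le> i \<and> i \<le> n \<and> 1 \<le> j \<and> j \<le> i - 2} \<rparr>"

definition backward_family :: "nat \<Rightarrow> nat pair_pre_digraph set" where
  "backward_family n =
    {backward_tournament n \<lparr> parcs := parcs (backward_tournament n) \<union> S \<rparr> | S.
      S \<subseteq> {(i, i - 1) | i. 2 \<le> i \<and> i \<le> n}}"

text \<open>Membership of an arbitrary digraph in this family is up to isomorphism,
  that is, up to the choice of the labelling \<open>v\<^sub>1, \<dots>, v\<^sub>n\<close> of its vertices.\<close>
definition in_backward_family :: "nat \<Rightarrow> 'a pair_pre_digraph \<Rightarrow> bool" where
  "in_backward_family n G \<longleftrightarrow>
    (\<exists>H \<in> backward_family n. digraph_iso (with_proj H) (with_proj G))"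

end

theory Submission
  imports Defs
begin

text \<open>
  The upper bounds only use \<open>1 \<le> D(G') \<le> D(G) \<le> n - 1\<close> for the symmetric version \<open>G'\<close>, so equality
  in either of them means \<open>D(G) = n - 1\<close> and \<open>D(G') = 1\<close>. In that case a longest shortest path is a
  Hamiltonian path \<open>v\<^sub>1, \<dots>, v\<^sub>n\<close>; being shortest, it admits no arrow \<open>(v\<^sub>i, v\<^sub>j)\<close> with \<open>j \<ge> i + 2\<close>,
  and since any two vertices are adjacent in \<open>G'\<close>, all arrows \<open>(v\<^sub>j, v\<^sub>i)\<close> with \<open>j \<ge> i + 2\<close> are present.
  Conversely, in a member of the family every arrow raises the index by at most one, so the
  distance from \<open>v\<^sub>1\<close> to \<open>v\<^sub>n\<close> is \<open>n - 1\<close>.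
\<close>

section \<open>Distances and diameters\<close>

lemma (in wf_digraph) shortest_apath:
  assumes "u \<rightarrow>\<^sup>* v"
  obtains p where "apath u p v" "length p = dist_in G u v"
proof -
  have "\<exists>p. apath u p v \<and> length p = dist_in G u v"
    unfolding dist_in_def by (rule LeastI_ex) (use assms reachable_apath in auto)
  then show ?thesis using that by blast
qed

text \<open>\<open>dist_in\<close> minimises over paths only. With unit arc costs it equals
  \<open>\<mu>\<close>, an infimum over all walks, so walks that repeat vertices also bound it from
  above.\<close>

lemma (in fin_digraph) dist_in_le_awalk:
  assumes "awalk u p v"
  shows "dist_in G u v \<le> length p"
proof -
  have cost: "awalk_cost (\<lambda>_. 1) p = real (length p)"
    by (induct p) auto
  have "u \<rightarrow>\<^sup>* v"
    using assms reachable_awalk by blast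
  then have "ereal (real (dist_in G u v)) \<le> ereal (real (length p))"
    using min_cost_le_walk_cost[OF assms, of "\<lambda>_. 1"] by (simp add: dist_in_eq_\<mu> cost)
  then show ?thesis by simp
qed

lemma (in fin_digraph) finite_dists:
  "finite {dist_in G x y | x y. x \<in> verts G \<and> y \<in> verts G}"
proof -
  have "{dist_in G x y | x y. x \<in> verts G \<and> y \<in> verts G}
      = (\<lambda>(x, y). dist_in G x y) ` (verts G \<times> verts G)"
    by auto
  then show ?thesis by simp
qed

lemma (in fin_digraph) dist_in_le_diameter:
  assumes "x \<in> verts G" "y \<in> verts G"
  shows "dist_in G x y \<le> diameter G"
  unfolding diameter_def by (rule Max_ge[OF finite_dists]) (use assms in auto)

lemma (in fin_digraph) diameter_attained:
  assumes "verts G \<noteq> {}"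
  obtains x y where "x \<in> verts G" "y \<in> verts G" "dist_in G x y = diameter G"
proof -
  have "diameter G \<in> {dist_in G x y | x y. x \<in> verts G \<and> y \<in> verts G}"
    unfolding diameter_def by (rule Max_in[OF finite_dists]) (use assms in auto)
  then show ?thesis using that by auto
qed

text \<open>A shortest path repeats no vertex, so it has fewer arcs than the digraph has vertices.
  This is the source of the bound \<open>n - 1\<close>.\<close>

lemma (in fin_digraph) diameter_less_card:
  assumes "strongly_connected G"
  shows "diameter G < card (verts G)"
proof -
  have "verts G \<noteq> {}"
    using assms by (simp add: strongly_connected_def)
  then obtain x y where "x \<in> verts G" "y \<in> verts G" and d: "dist_in G x y = diameter G"
    by (rule diameter_attained)
  then have "x \<rightarrow>\<^sup>* y"
    using assms by auto
  then show ?thesis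
    using d by (metis shortest_apath length_apath_less)
qed

lemma (in fin_digraph) diameter_pos:
  assumes "strongly_connected G" "x \<in> verts G" "y \<in> verts G" "x \<noteq> y"
  shows "1 \<le> diameter G"
proof -
  have "x \<rightarrow>\<^sup>* y"
    using assms by auto
  then obtain p where "apath x p y" "length p = dist_in G x y"
    by (rule shortest_apath)
  then have "dist_in G x y \<noteq> 0"
    using assms by (cases p) (auto simp: apath_Nil_iff)
  then show ?thesis
    using dist_in_le_diameter[OF assms(2,3)] by linarith
qed

lemma (in fin_digraph) diameter_le_1_imp_adj:
  assumes "strongly_connected G" "diameter G \<le> 1" "x \<in> verts G" "y \<in> verts G" "x \<noteq> y"
  shows "(x, y) \<in> arcs_ends G"
proof -
  have "x \<rightarrow>\<^sup>* y"
    using assms by auto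
  then obtain p where p: "apath x p y" "length p = dist_in G x y"
    by (rule shortest_apath)
  then have "length p \<le> 1"
    using assms dist_in_le_diameter[of x y] by linarith
  then show ?thesis
    using p(1) assms(5)
    by (cases p) (auto simp: apath_Nil_iff apath_Cons_iff arcs_ends_conv)
qed

lemma (in fin_digraph) diameter_le_1I:
  assumes "verts G \<noteq> {}"
    and "\<And>x y. x \<in> verts G \<Longrightarrow> y \<in> verts G \<Longrightarrow> x \<noteq> y \<Longrightarrow> (x, y) \<in> arcs_ends G"
  shows "diameter G \<le> 1"
proof -
  obtain x y where xy: "x \<in> verts G" "y \<in> verts G" and d: "dist_in G x y = diameter G"
    using assms(1) by (rule diameter_attained)
  have "\<exists>p. awalk x p y \<and> length p \<le> 1"
  proof (cases "x = y")
    case True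
    then show ?thesis
      using xy by (intro exI[of _ "[]"]) (simp add: awalk_Nil_iff)
  next
    case False
    with assms(2) xy obtain e where "e \<in> arcs G" "tail G e = x" "head G e = y"
      by blast
    then show ?thesis
      by (intro exI[of _ "[e]"]) (auto simp: awalk_simps)
  qed
  then show ?thesis
    using dist_in_le_awalk d by fastforce
qed

text \<open>Serves to cut a longest shortest path at chosen vertices, both to read off its single
  arcs and to replace a middle segment by a shortcut.\<close>

lemma (in wf_digraph) awalk_split_nth:
  assumes "awalk u p v" "i \<le> length p"
  shows "awalk u (take i p) (awalk_verts u p ! i) \<and> awalk (awalk_verts u p ! i) (drop i p) v"
  using assms
proof (induct p arbitrary: u i)
  case Nil
  then show ?case by (auto simp: awalk_Nil_iff)
next
  case (Cons e p)
  then show ?case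
    by (cases i) (auto simp: awalk_Cons_iff awalk_Nil_iff)
qed

section \<open>The symmetric version of a digraph\<close>

lemma strongly_connected_mk_symmetric:
  assumes "wf_digraph G" "strongly_connected G"
  shows "strongly_connected (with_proj (mk_symmetric G))"
  using assms wf_digraph.reachable_mk_symmetricI[OF assms(1)]
  by (auto simp: strongly_connected_def)

text \<open>Identifies the library's \<open>mk_symmetric\<close> with the usual symmetric version,
  in which an arc in either direction yields arcs in both.\<close>

lemma parcs_mk_symmetric_with_proj:
  "(x, y) \<in> parcs (mk_symmetric (with_proj G)) \<longleftrightarrow> (x, y) \<in> parcs G \<or> (y, x) \<in> parcs G"
proof -
  have "(x, y) \<in> parcs (mk_symmetric (with_proj G))" if "(y, x) \<in> parcs G"
    unfolding parcs_mk_symmetric by (rule UN_I[of "(y, x)"]) (use that in auto)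
  then show ?thesis
    by (auto simp: parcs_mk_symmetric)
qed

text \<open>Adding arcs preserves walks, so distances can only shrink. This is applied to a pair
  that attains the diameter of the symmetric version.\<close>

lemma (in pair_fin_digraph) diameter_mk_symmetric_le:
  assumes "strongly_connected (with_proj G)"
  shows "diameter (with_proj (mk_symmetric (with_proj G))) \<le> diameter (with_proj G)"
proof -
  interpret S: pair_fin_digraph "mk_symmetric (with_proj G)" ..
  have "pverts (mk_symmetric (with_proj G)) \<noteq> {}"
    using assms by (simp add: strongly_connected_def)
  then obtain x y where "x \<in> pverts (mk_symmetric (with_proj G))"
      "y \<in> pverts (mk_symmetric (with_proj G))"
    and d: "dist_in (mk_symmetric (with_proj G)) x y = diameter (mk_symmetric (with_proj G))"
    by (rule S.diameter_attained)
  then have xy: "x \<in> pverts G" "y \<in> pverts G"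
    by simp_all
  have "x \<rightarrow>\<^sup>*\<^bsub>with_proj G\<^esub> y"
    using assms xy by auto
  then obtain p where p: "apath x p y" "length p = dist_in G x y"
    by (rule shortest_apath)
  have "parcs G \<subseteq> parcs (mk_symmetric (with_proj G))"
    by (auto simp: parcs_mk_symmetric_with_proj)
  then have "S.awalk x p y"
    using awalkI_apath[OF p(1)] by (auto simp: awalk_def S.awalk_def)
  then show ?thesis
    using S.dist_in_le_awalk d p(2) dist_in_le_diameter[OF xy] by (metis order.trans)
qed

section \<open>Labellings exhibiting membership in the family\<close>

text \<open>Merges the family and the isomorphism into a single map. Arcs from
  \<open>f (i + 1)\<close> to \<open>f i\<close> are left unconstrained, which encodes the arbitrary
  set of added arrows.\<close>

definition backward_labelling :: "nat \<Rightarrow> 'a pair_pre_digraph \<Rightarrow> (nat \<Rightarrow> 'a) \<Rightarrow> bool" where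
  "backward_labelling n G f \<longleftrightarrow> bij_betw f {1..n} (pverts G) \<and>
    (\<forall>i\<in>{1..n}. \<forall>j\<in>{1..n}.
      (j = i + 1 \<or> j + 2 \<le> i \<longrightarrow> (f i, f j) \<in> parcs G) \<and>
      (i + 2 \<le> j \<or> i = j \<longrightarrow> (f i, f j) \<notin> parcs G))"

lemma backward_labellingD:
  assumes "backward_labelling n G f"
  shows "bij_betw f {1..n} (pverts G)"
    and "i \<in> {1..n} \<Longrightarrow> i + 1 \<in> {1..n} \<Longrightarrow> (f i, f (i + 1)) \<in> parcs G"
    and "i \<in> {1..n} \<Longrightarrow> j \<in> {1..n} \<Longrightarrow> j + 2 \<le> i \<Longrightarrow> (f i, f j) \<in> parcs G"
    and "i \<in> {1..n} \<Longrightarrow> j \<in> {1..n} \<Longrightarrow> i + 2 \<le> j \<Longrightarrow> (f i, f j) \<notin> parcs G"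
    and "i \<in> {1..n} \<Longrightarrow> (f i, f i) \<notin> parcs G"
  using assms unfolding backward_labelling_def by blast+

lemma backward_labelling_obtain:
  assumes "backward_labelling n G f" "x \<in> pverts G"
  obtains i where "i \<in> {1..n}" "x = f i"
  using assms backward_labellingD(1) bij_betw_imp_surj_on by blast

lemma parcs_backward_family:
  assumes "S \<subseteq> {(i, i - 1) | i. 2 \<le> i \<and> i \<le> n}"
  shows "(i, j) \<in> parcs (backward_tournament n) \<union> S \<longleftrightarrow>
    i \<in> {1..n} \<and> j \<in> {1..n} \<and> (j = i + 1 \<or> j + 2 \<le> i \<or> (i, j) \<in> S)"
  using assms by (auto simp: backward_tournament_def)

lemma in_backward_family_imp_labelling:
  assumes "in_backward_family n G"
  obtains f where "backward_labelling n G f"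
proof -
  obtain S hom where S: "S \<subseteq> {(i, i - 1) | i. 2 \<le> i \<and> i \<le> n}"
    and hom: "pre_digraph.digraph_isomorphism
      (with_proj (backward_tournament n \<lparr> parcs := parcs (backward_tournament n) \<union> S \<rparr>)) hom"
    and G: "with_proj G = app_iso hom
      (with_proj (backward_tournament n \<lparr> parcs := parcs (backward_tournament n) \<union> S \<rparr>))"
    using assms by (auto simp: in_backward_family_def backward_family_def digraph_iso_def)
  define H where "H = backward_tournament n \<lparr> parcs := parcs (backward_tournament n) \<union> S \<rparr>"
  define f where "f = iso_verts hom"
  note hom = hom[folded H_def] and G = G[folded H_def]
  interpret H: wf_digraph "with_proj H"
    using hom by (simp add: pre_digraph.digraph_isomorphism_def)
  have vH: "pverts H = {1..n}"
    by (simp add: H_def backward_tournament_def)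
  have pG: "parcs G = (\<lambda>(u, v). (f u, f v)) ` parcs H"
    using H.arcs_ends_app_iso_eq[OF hom] G
    by (metis with_proj_simps(3) f_def)
  have vG: "pverts G = f ` {1..n}"
    using arg_cong[OF G, of verts] by (simp add: f_def vH)
  have inj: "inj_on f {1..n}"
    using H.digraph_isomorphism_inj_on_verts[OF hom] by (simp add: f_def vH)
  have "(f i, f j) \<in> parcs G \<longleftrightarrow> (i, j) \<in> parcs H" if "i \<in> {1..n}" "j \<in> {1..n}" for i j
  proof
    assume "(f i, f j) \<in> parcs G"
    then obtain a b where ab: "(a, b) \<in> parcs H" "f i = f a" "f j = f b"
      by (auto simp: pG)
    \<comment> \<open>Wellformedness puts \<open>a\<close> and \<open>b\<close> where
      \<open>f\<close> is injective, so they must be \<open>i\<close> and \<open>j\<close>.\<close>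
    then have "a \<in> {1..n}" "b \<in> {1..n}"
      using H.wellformed[of "(a, b)"] by (auto simp: vH)
    then show "(i, j) \<in> parcs H"
      using ab inj that by (metis inj_onD)
  qed (auto simp: pG)
  moreover have "(i, j) \<in> parcs H \<longleftrightarrow> i \<in> {1..n} \<and> j \<in> {1..n} \<and>
      (j = i + 1 \<or> j + 2 \<le> i \<or> (i, j) \<in> S)" for i j
    using parcs_backward_family[OF S] by (simp add: H_def)
  \<comment> \<open>The bound \<open>2 \<le> i\<close> keeps truncated subtraction from turning
    \<open>(i, i - 1)\<close> into a loop.\<close>
  moreover have "(i, j) \<notin> S" if "i + 2 \<le> j \<or> i = j" for i j
    using S that by auto
  ultimately have "backward_labelling n G f"
    using inj vG by (simp add: backward_labelling_def bij_betw_def)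
  then show ?thesis by (rule that)
qed

lemma (in pair_wf_digraph) in_backward_family_if_labelling:
  assumes f: "backward_labelling n G f"
  shows "in_backward_family n G"
proof -
  \<comment> \<open>The set of added arrows is read off from \<open>G\<close>: the arcs that lower
    the label by exactly one.\<close>
  define S where "S = {(i, i - 1) | i. 2 \<le> i \<and> i \<le> n \<and> (f i, f (i - 1)) \<in> parcs G}"
  define H where "H = backward_tournament n \<lparr> parcs := parcs (backward_tournament n) \<union> S \<rparr>"
  \<comment> \<open>Arcs are pairs of their ends, so the vertex map determines the arc map.\<close>
  define hom where "hom = \<lparr> iso_verts = f, iso_arcs = map_prod f f,
    iso_head = snd, iso_tail = fst \<rparr>"
  have S: "S \<subseteq> {(i, i - 1) | i. 2 \<le> i \<and> i \<le> n}"
    by (auto simp: S_def)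
  have vH: "pverts H = {1..n}"
    by (simp add: H_def backward_tournament_def)
  have bij: "bij_betw f {1..n} (pverts G)"
    using f by (simp add: backward_labelling_def)
  have pH: "(i, j) \<in> parcs H \<longleftrightarrow> i \<in> {1..n} \<and> j \<in> {1..n} \<and> (f i, f j) \<in> parcs G" for i j
  proof -
    have *: "(i, j) \<in> parcs H \<longleftrightarrow> i \<in> {1..n} \<and> j \<in> {1..n} \<and>
        (j = i + 1 \<or> j + 2 \<le> i \<or> (i, j) \<in> S)"
      using parcs_backward_family[OF S] by (simp add: H_def)
    consider "j = i + 1" | "j + 2 \<le> i" | "i + 2 \<le> j" | "i = j" | "i = j + 1"
      by linarith
    then show ?thesis
      unfolding *
      by cases (use backward_labellingD(2-)[OF f] in \<open>auto simp: S_def\<close>)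
  qed
  have "wf_digraph (with_proj H)"
    by unfold_locales (auto simp: pH vH)
  moreover have "inj_on (map_prod f f) (parcs H)"
    using map_prod_inj_on[OF bij_betw_imp_inj_on[OF bij] bij_betw_imp_inj_on[OF bij]]
    by (rule inj_on_subset) (auto simp: pH)
  ultimately have "pre_digraph.digraph_isomorphism (with_proj H) hom"
    using bij by (auto simp: pre_digraph.digraph_isomorphism_def hom_def vH bij_betw_def)
  moreover have "map_prod f f ` parcs H = parcs G"
  proof
    show "map_prod f f ` parcs H \<subseteq> parcs G"
      by (auto simp: pH)
    show "parcs G \<subseteq> map_prod f f ` parcs H"
    proof
      fix e assume e: "e \<in> parcs G"
      obtain i j where "i \<in> {1..n}" "j \<in> {1..n}" "e = (f i, f j)"
        using backward_labelling_obtain[OF f arc_fst_in_verts[OF e]]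
          backward_labelling_obtain[OF f arc_snd_in_verts[OF e]]
        by (metis prod.collapse)
      then show "e \<in> map_prod f f ` parcs H"
        using e pH by force
    qed
  qed
  then have "with_proj G = app_iso hom (with_proj H)"
    using bij by (simp add: app_iso_def hom_def vH bij_betw_def with_proj_def)
  ultimately have "digraph_iso (with_proj H) (with_proj G)"
    unfolding digraph_iso_def by blast
  moreover have "H \<in> backward_family n"
    using S by (auto simp: backward_family_def H_def)
  ultimately show ?thesis
    unfolding in_backward_family_def by blast
qed

section \<open>Members of the family are extremal\<close>

text \<open>No arc raises the label by two or more, so by induction on the walk each arc gains at
  most one.\<close>

lemma (in pair_wf_digraph) backward_labelling_awalk_length:
  assumes f: "backward_labelling n G f"
    and "awalk (f i) p (f j)" "i \<in> {1..n}" "j \<in> {1..n}"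
  shows "j \<le> i + length p"
  using assms(2-)
proof (induct p arbitrary: i)
  case Nil
  then have "f i = f j"
    by (simp add: awalk_Nil_iff)
  then show ?case
    using bij_betw_imp_inj_on[OF backward_labellingD(1)[OF f]] Nil by (simp add: inj_on_eq_iff)
next
  case (Cons e p)
  then have e: "e \<in> parcs G" "fst e = f i" and w: "awalk (snd e) p (f j)"
    by (auto simp: awalk_Cons_iff)
  obtain k where k: "k \<in> {1..n}" "snd e = f k"
    using f arc_snd_in_verts[OF e(1)] by (rule backward_labelling_obtain)
  then have "(f i, f k) \<in> parcs G"
    using e by (metis prod.collapse)
  then have "\<not> i + 2 \<le> k"
    using backward_labellingD(4)[OF f Cons.prems(2) k(1)] by blast
  moreover have "j \<le> k + length p"
    using Cons.hyps[of k] w k Cons.prems by simp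
  ultimately show ?case by simp
qed

text \<open>A path from \<open>f 1\<close> to \<open>f n\<close> has to raise the label by
  \<open>n - 1\<close>, at most one per arc.\<close>

lemma (in pair_fin_digraph) diameter_backward_labelling:
  assumes f: "backward_labelling n G f" and n: "1 \<le> n"
    and sc: "strongly_connected (with_proj G)"
  shows "n - 1 \<le> diameter (with_proj G)"
proof -
  have v: "f 1 \<in> pverts G" "f n \<in> pverts G"
    using f n by (auto simp: backward_labelling_def bij_betw_def)
  then have "f 1 \<rightarrow>\<^sup>*\<^bsub>with_proj G\<^esub> f n"
    using sc by auto
  then obtain p where "apath (f 1) p (f n)" "length p = dist_in G (f 1) (f n)"
    by (rule shortest_apath)
  then have "n \<le> 1 + dist_in G (f 1) (f n)"
    using backward_labelling_awalk_length[OF f awalkI_apath, of 1 p n] n by auto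
  then show ?thesis
    using dist_in_le_diameter[OF v] by linarith
qed

text \<open>Distinct labels differ by one or by at least two. In either case the labelling supplies
  an arc in one direction, hence adjacency in the symmetric version.\<close>

lemma (in pair_fin_digraph) diameter_mk_symmetric_backward_labelling:
  assumes f: "backward_labelling n G f" and "pverts G \<noteq> {}"
  shows "diameter (with_proj (mk_symmetric (with_proj G))) \<le> 1"
proof -
  interpret S: pair_fin_digraph "mk_symmetric (with_proj G)" ..
  show ?thesis
  proof (rule S.diameter_le_1I)
    fix x y assume "x \<in> pverts (mk_symmetric (with_proj G))"
      "y \<in> pverts (mk_symmetric (with_proj G))" "x \<noteq> y"
    then obtain i j where ij: "i \<in> {1..n}" "j \<in> {1..n}" "x = f i" "y = f j" "i \<noteq> j"
      using backward_labelling_obtain[OF f] by (metis pverts_mk_symmetric with_proj_simps(1))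
    then consider "j = i + 1" | "j + 2 \<le> i" | "i + 2 \<le> j" | "i = j + 1"
      by linarith
    then have "(x, y) \<in> parcs G \<or> (y, x) \<in> parcs G"
      unfolding ij(3,4)
      by cases (use backward_labellingD(2,3)[OF f] ij(1,2) in auto)
    then show "(x, y) \<in> parcs (mk_symmetric (with_proj G))"
      by (simp add: parcs_mk_symmetric_with_proj)
  qed (use assms in simp)
qed

section \<open>Extremal digraphs belong to the family\<close>

lemma (in pair_digraph) backward_labelling_if_extremal:
  assumes sc: "strongly_connected (with_proj G)"
    and d: "diameter (with_proj G) = card (pverts G) - 1"
    and s: "diameter (with_proj (mk_symmetric (with_proj G))) \<le> 1"
  obtains f where "backward_labelling (card (pverts G)) G f"
proof -
  interpret S: pair_fin_digraph "mk_symmetric (with_proj G)" ..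
  define n where "n = card (pverts G)"
  have ne: "pverts G \<noteq> {}"
    using sc by (simp add: strongly_connected_def)
  then have n: "1 \<le> n"
    using pair_finite_verts by (simp add: n_def Suc_le_eq card_gt_0_iff)
  obtain x y where xy: "x \<in> pverts G" "y \<in> pverts G"
    and "dist_in G x y = diameter G"
    using ne by (rule diameter_attained)
  then have dxy: "dist_in G x y = n - 1"
    using d by (simp add: n_def)
  from xy have "x \<rightarrow>\<^sup>*\<^bsub>with_proj G\<^esub> y"
    using sc by auto
  then obtain p where p: "apath x p y" "length p = n - 1"
    using dxy by (metis shortest_apath)
  define vs where "vs = pawalk_verts x p"
  \<comment> \<open>Positions in \<open>vs\<close> start at 0, labels at 1.\<close>
  define f where "f i = vs ! (i - 1)" for i
  have w: "awalk x p y"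
    using p(1) by (rule awalkI_apath)
  have len: "length vs = n"
    using length_awalk_verts[of x p] p(2) n by (simp add: vs_def)
  have dist: "distinct vs"
    using p(1) by (simp add: apath_def vs_def)
  have "set vs \<subseteq> pverts G"
    using w unfolding awalk_conv vs_def by blast
  \<comment> \<open>The \<open>n\<close> distinct entries of \<open>vs\<close> exhaust the
    \<open>n\<close> vertices: the path is Hamiltonian.\<close>
  then have set_vs: "set vs = pverts G"
    using pair_finite_verts dist len
    by (metis card_subset_eq distinct_card n_def)
  have split: "awalk x (take i p) (vs ! i)" "awalk (vs ! i) (drop i p) y" if "i \<le> n - 1" for i
    using awalk_split_nth[OF w, of i] that p(2) by (simp_all add: vs_def)
  \<comment> \<open>The suffix of \<open>p\<close> from position \<open>i\<close> fixes the tail of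
    the arc \<open>p ! i\<close>; the prefix of length \<open>i + 1\<close> fixes its head.\<close>
  have succ: "(vs ! i, vs ! (i + 1)) \<in> parcs G" if "i + 1 < n" for i
  proof -
    have "drop i p = p ! i # drop (i + 1) p"
      using that p(2) by (simp add: Cons_nth_drop_Suc)
    then have e: "p ! i \<in> parcs G" "fst (p ! i) = vs ! i" "awalk (snd (p ! i)) (drop (i + 1) p) y"
      using split(2)[of i] that by (auto simp: awalk_Cons_iff)
    have "take (i + 1) p = take i p @ [p ! i]"
      using that p(2) by (simp add: take_Suc_conv_app_nth)
    then have "awalk x (take i p @ [p ! i]) (vs ! (i + 1))"
      using split(1)[of "i + 1"] that by simp
    then have "snd (p ! i) = vs ! (i + 1)"
      by (auto simp: awalk_append_iff awalk_Cons_iff awalk_Nil_iff)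
    then show ?thesis
      using e by (metis prod.collapse)
  qed
  \<comment> \<open>Such an arc would replace \<open>j - i \<ge> 2\<close> arcs of \<open>p\<close>
    by one, giving a walk from \<open>x\<close> to \<open>y\<close> shorter than their distance
    \<open>n - 1\<close>.\<close>
  have jump: "(vs ! i, vs ! j) \<notin> parcs G" if "i + 2 \<le> j" "j < n" for i j
  proof
    assume a: "(vs ! i, vs ! j) \<in> parcs G"
    then have "awalk (vs ! i) ((vs ! i, vs ! j) # drop j p) y"
      using split(2)[of j] that by (auto simp: awalk_Cons_iff)
    then have "awalk x (take i p @ (vs ! i, vs ! j) # drop j p) y"
      using split(1)[of i] that by (intro awalk_appendI) auto
    from dist_in_le_awalk[OF this] show False
      using that p(2) dxy by simp
  qed
  \<comment> \<open>Diameter at most 1 makes the two vertices adjacent in the symmetric version;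
    \<open>jump\<close> excludes the forward direction.\<close>
  have back_arc: "(vs ! j, vs ! i) \<in> parcs G" if "i + 2 \<le> j" "j < n" for i j
  proof -
    have "(vs ! i, vs ! j) \<in> parcs (mk_symmetric (with_proj G))"
      using that len dist set_vs nth_mem[of i vs] nth_mem[of j vs]
      by (intro S.diameter_le_1_imp_adj strongly_connected_mk_symmetric sc s wf_digraph)
        (auto simp: nth_eq_iff_index_eq)
    then show ?thesis
      using jump[OF that] by (simp add: parcs_mk_symmetric_with_proj)
  qed
  have "bij_betw f {1..n} (pverts G)"
    unfolding bij_betw_def
  proof
    show "inj_on f {1..n}"
      using dist len by (auto simp: inj_on_def f_def nth_eq_iff_index_eq)
    have "f ` {1..n} = (\<lambda>i. vs ! i) ` {..<n}"
      unfolding f_def by (force simp: image_iff intro: bexI[of _ "Suc _"])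
    then show "f ` {1..n} = pverts G"
      using set_vs len by (auto simp: set_conv_nth)
  qed
  moreover have "(f i, f j) \<in> parcs G" if "i \<in> {1..n}" "j \<in> {1..n}" "j = i + 1" for i j
    using succ[of "i - 1"] that by (simp add: f_def)
  moreover have "(f i, f j) \<in> parcs G" if "i \<in> {1..n}" "j \<in> {1..n}" "j + 2 \<le> i" for i j
    using back_arc[of "j - 1" "i - 1"] that by (simp add: f_def)
  moreover have "(f i, f j) \<notin> parcs G" if "i \<in> {1..n}" "j \<in> {1..n}" "i + 2 \<le> j" for i j
    using jump[of "i - 1" "j - 1"] that by (simp add: f_def)
  moreover have "(f i, f i) \<notin> parcs G" for i
    using no_loops' by blast
  ultimately have "backward_labelling n G f"
    unfolding backward_labelling_def by blast
  then show ?thesis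
    using that by (simp add: n_def)
qed

section \<open>The two bounds and their equality cases\<close>

theorem theorem1:
  fixes G :: "'a pair_pre_digraph" and n :: nat
  assumes "n \<ge> 3"
    and "pair_digraph G"
    and "card (pverts G) = n"
    and "strongly_connected (with_proj G)"
  shows "\<bar>int (diameter (with_proj G)) - int (diameter (with_proj (mk_symmetric (with_proj G))))\<bar>
           \<le> int n - 2
    \<and> real (diameter (with_proj G)) / real (diameter (with_proj (mk_symmetric (with_proj G))))
           \<le> real n - 1
    \<and> (\<bar>int (diameter (with_proj G)) - int (diameter (with_proj (mk_symmetric (with_proj G))))\<bar>
           = int n - 2 \<longleftrightarrow> in_backward_family n G)
    \<and> (real (diameter (with_proj G)) / real (diameter (with_proj (mk_symmetric (with_proj G))))
           = real n - 1 \<longleftrightarrow> in_backward_family n G)"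
proof -
  interpret pair_digraph G by fact
  interpret S: pair_fin_digraph "mk_symmetric (with_proj G)" ..
  define d where "d = diameter (with_proj G)"
  define s where "s = diameter (with_proj (mk_symmetric (with_proj G)))"
  note sc = assms(4)
  have scS: "strongly_connected (with_proj (mk_symmetric (with_proj G)))"
    using sc by (intro strongly_connected_mk_symmetric wf_digraph)
  have ne: "pverts G \<noteq> {}"
    using assms by auto
  \<comment> \<open>Two distinct vertices give \<open>1 \<le> s\<close>, which also keeps the
    quotient \<open>d / s\<close> clear of division by zero.\<close>
  have "\<not> card (pverts G) \<le> Suc 0"
    using assms by simp
  then obtain x y where "x \<in> pverts G" "y \<in> pverts G" "x \<noteq> y"
    using pair_finite_verts by (auto simp: card_le_Suc0_iff_eq)
  then have s1: "1 \<le> s"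
    unfolding s_def by (intro S.diameter_pos[OF scS]) auto
  have sd: "s \<le> d"
    unfolding s_def d_def using sc by (rule diameter_mk_symmetric_le)
  have dn: "d < n"
    using diameter_less_card[OF sc] assms(3) by (simp add: d_def)
  have family: "in_backward_family n G \<longleftrightarrow> d = n - 1 \<and> s = 1"
  proof
    assume "in_backward_family n G"
    then obtain f where f: "backward_labelling n G f"
      by (rule in_backward_family_imp_labelling)
    show "d = n - 1 \<and> s = 1"
      using diameter_backward_labelling[OF f _ sc] assms(1) dn s1
        diameter_mk_symmetric_backward_labelling[OF f ne]
      by (simp add: d_def s_def)
  next
    assume "d = n - 1 \<and> s = 1"
    then obtain f where "backward_labelling n G f"
      using backward_labelling_if_extremal[OF sc] assms(3) by (auto simp: d_def s_def)
    then show "in_backward_family n G"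
      by (rule in_backward_family_if_labelling)
  qed
  have diff: "\<bar>int d - int s\<bar> \<le> int n - 2"
    using s1 sd dn by linarith
  \<comment> \<open>Since \<open>d \<le> n - 1\<close> and \<open>1 \<le> s\<close>, the difference
    reaches \<open>n - 2\<close> only if both bounds are attained.\<close>
  have diff_eq: "\<bar>int d - int s\<bar> = int n - 2 \<longleftrightarrow> d = n - 1 \<and> s = 1"
    using s1 sd dn by linarith
  have "real d / real s \<le> real d"
    using s1 by (simp add: divide_le_eq mult_le_cancel_left1)
  moreover have dn': "real d \<le> real n - 1"
    using dn by linarith
  ultimately have ratio: "real d / real s \<le> real n - 1"
    by linarith
  have ratio_eq: "real d / real s = real n - 1 \<longleftrightarrow> d = n - 1 \<and> s = 1"
  proof
    assume eq: "real d / real s = real n - 1"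
    \<comment> \<open>As \<open>d\<close> is positive, \<open>s \<ge> 2\<close> would make
      \<open>d / s\<close> strictly smaller than \<open>d\<close>, hence smaller than
      \<open>n - 1\<close>.\<close>
    have "s = 1"
    proof (rule ccontr)
      assume "s \<noteq> 1"
      then have "real d / real s < real d"
        using s1 sd by (simp add: divide_less_eq)
      then show False
        using eq dn' by linarith
    qed
    with eq dn show "d = n - 1 \<and> s = 1"
      by simp
  qed (use dn in simp)
  show ?thesis
    using diff ratio by (fold d_def s_def) (simp add: family diff_eq ratio_eq)
qed

end
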